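(* Let $\mathcal{A}$ be a discrete alphabet set (finite or infinite) with at least two elements, let $\Omega=\mathcal{A}^{\mathbb{N}}$ be the full shift space with shift map $\sigma$, and let $\overline{\sigma}$ be the induced map on the hyperspace $\mathcal{K}(\Omega)$ of nonempty compact subsets of $\Omega$. Then $(\mathcal{K}(\Omega),\overline{\sigma})$ is sensitive with sensitivity constant $\frac12$.
   Context: Sequences in $\mathcal{A}^{\mathbb{N}}$ are indexed from $0$, and $\sigma(x_0x_1x_2\ldots)=x_1x_2x_3\ldots$. The space $\mathcal{A}^{\mathbb{N}}$ carries the metric $D(\bar x,\bar y)=\sum_{i=0}^\infty \frac{\delta(x_i,y_i)}{2^i}$, where $\delta$ is the discrete metric on $\mathcal{A}$. $\mathcal{K}(\Omega)$ is the set of nonempty compact subsets of $\Omega$ with the Hausdorff metric $D_H$ induced by $D$, and $\overline{\sigma}(K)=\sigma(K)=\{\sigma(\bar x):\bar x\in K\}$. A continuous self-map $f$ of a metric space $(X,\rho)$ is sensitive with sensitivity constant $\delta>0$ if for every $x\in X$ and every $\epsilon>0$ there exist $y\in X$ and a positive integer $n$ with $\rho(x,y)<\epsilon$ and $\rho(f^n(x),f^n(y))>\delta$. *)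

theory Defs
  imports "HOL-Analysis.Analysis"
begin

definition full_shift :: "'a set \<Rightarrow> (nat \<Rightarrow> 'a) set" where
  "full_shift A = {x. \<forall>i. x i \<in> A}"

definition shift :: "(nat \<Rightarrow> 'a) \<Rightarrow> nat \<Rightarrow> 'a" where
  "shift x = (\<lambda>i. x (Suc i))"

definition shift_dist :: "(nat \<Rightarrow> 'a) \<Rightarrow> (nat \<Rightarrow> 'a) \<Rightarrow> real" where
  "shift_dist x y = (\<Sum>i. discrete_metric.dd (x i) (y i) / 2 ^ i)"

definition hyperspace :: "'b set \<Rightarrow> ('b \<Rightarrow> 'b \<Rightarrow> real) \<Rightarrow> 'b set set" where
  "hyperspace X d = {K. K \<noteq> {} \<and> compactin (Metric_space.mtopology X d) K}"

text \<open>The value at the empty set, which never lies in the hyperspace, only serves to make the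
  function nonnegative everywhere, as the library's \<^locale>\<open>Metric_space\<close> requires of a metric also
  outside its carrier.\<close>

definition hausdorff_dist :: "('b \<Rightarrow> 'b \<Rightarrow> real) \<Rightarrow> 'b set \<Rightarrow> 'b set \<Rightarrow> real" where
  "hausdorff_dist d K L =
     (if K = {} \<or> L = {} then 0
      else max (SUP x\<in>K. INF y\<in>L. d x y) (SUP y\<in>L. INF x\<in>K. d x y))"

text \<open>That \<open>f\<close> is a continuous self-map of a metric space is part of the notion.\<close>

definition sensitive_with_constant ::
    "'b set \<Rightarrow> ('b \<Rightarrow> 'b \<Rightarrow> real) \<Rightarrow> ('b \<Rightarrow> 'b) \<Rightarrow> real \<Rightarrow> bool" where
  "sensitive_with_constant X d f c \<longleftrightarrow>
     Metric_space X d \<and>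
     continuous_map (Metric_space.mtopology X d) (Metric_space.mtopology X d) f \<and>
     c > 0 \<and>
     (\<forall>x\<in>X. \<forall>\<epsilon>>0. \<exists>y\<in>X. \<exists>n>0. d x y < \<epsilon> \<and> d ((f ^^ n) x) ((f ^^ n) y) > c)"

end

theory Submission
  imports Defs
begin

text \<open>
  Given a compact set \<open>K\<close>, cut all its points after a long prefix of length \<open>n\<close> and continue them
  with a constant letter \<open>c\<close>. The resulting compact set \<open>L\<close> is close to \<open>K\<close>, and its \<open>n\<close>-th image is
  the single point \<open>ccc\<dots>\<close>. If \<open>c\<close> differs from the letter at position \<open>n\<close> of some point of \<open>K\<close>, then
  the \<open>n\<close>-th image of \<open>K\<close> contains a point at distance at least \<open>1\<close> from \<open>ccc\<dots>\<close>.
\<close>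

text \<open>Boundedness is also required outside the carrier, because the Hausdorff distance has to be
  nonnegative for arbitrary sets and a real supremum is unspecified on unbounded sets.\<close>

locale bounded_metric_space = Metric_space +
  fixes B :: real
  assumes bounded: "d x y \<le> B"
begin

section \<open>Hausdorff distance for a bounded metric\<close>

lemma bdd_below_dist: "bdd_below ((\<lambda>y. d x y) ` L)" "bdd_below ((\<lambda>y. d y x) ` L)"
  by (auto intro!: bdd_belowI2[where m = 0])

lemma INF_dist_le: "L \<noteq> {} \<Longrightarrow> (INF y\<in>L. d x y) \<le> B" "L \<noteq> {} \<Longrightarrow> (INF y\<in>L. d y x) \<le> B"
  by (auto intro: cINF_lower2[OF bdd_below_dist(1)] cINF_lower2[OF bdd_below_dist(2)] bounded)

lemma bdd_above_INF_dist:
  "L \<noteq> {} \<Longrightarrow> bdd_above ((\<lambda>x. INF y\<in>L. d x y) ` K)"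
  "L \<noteq> {} \<Longrightarrow> bdd_above ((\<lambda>x. INF y\<in>L. d y x) ` K)"
  by (auto intro!: bdd_aboveI2[where M = B] INF_dist_le)

lemma hausdorff_dist_nonneg: "0 \<le> hausdorff_dist d K L"
proof (cases "K = {} \<or> L = {}")
  case False
  then obtain x where "x \<in> K" by blast
  have "0 \<le> (INF y\<in>L. d x y)"
    using False by (intro cINF_greatest) auto
  also have "\<dots> \<le> (SUP x\<in>K. INF y\<in>L. d x y)"
    using False \<open>x \<in> K\<close> by (intro cSUP_upper bdd_above_INF_dist) auto
  finally show ?thesis
    using False by (simp add: hausdorff_dist_def)
qed (auto simp: hausdorff_dist_def)

lemma hausdorff_dist_commute: "hausdorff_dist d K L = hausdorff_dist d L K"
  by (simp add: hausdorff_dist_def commute max.commute disj_commute)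

text \<open>Any single witness bounds the infimum from above. Together with
  \<open>hausdorff_dist_less_obtain\<close> this lets later arguments work with nearby points
  instead of suprema and infima.\<close>

lemma hausdorff_dist_leI:
  assumes "K \<noteq> {}" "L \<noteq> {}"
    and "\<And>x. x \<in> K \<Longrightarrow> \<exists>y\<in>L. d x y \<le> r" "\<And>y. y \<in> L \<Longrightarrow> \<exists>x\<in>K. d x y \<le> r"
  shows "hausdorff_dist d K L \<le> r"
proof -
  have "(INF y\<in>L. d x y) \<le> r" if "x \<in> K" for x
    using assms(3)[OF that] by (auto intro: cINF_lower2[OF bdd_below_dist(1)])
  moreover have "(INF x\<in>K. d x y) \<le> r" if "y \<in> L" for y
    using assms(4)[OF that] by (auto intro: cINF_lower2[OF bdd_below_dist(2)])
  ultimately show ?thesis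
    using assms(1,2) by (auto simp: hausdorff_dist_def intro!: cSUP_least)
qed

text \<open>The infimum over \<open>L\<close> need not be attained for arbitrary sets, so the bound
  has to be strict; proofs that start from the exact distance first add a small slack.\<close>

lemma hausdorff_dist_less_obtain:
  assumes "hausdorff_dist d K L < r" "K \<noteq> {}" "L \<noteq> {}" "x \<in> K"
  obtains y where "y \<in> L" "d x y < r"
proof -
  have "(INF y\<in>L. d x y) \<le> (SUP x\<in>K. INF y\<in>L. d x y)"
    using assms by (intro cSUP_upper bdd_above_INF_dist) auto
  also have "\<dots> < r"
    using assms by (simp add: hausdorff_dist_def)
  finally show ?thesis
    using cINF_less_iff[OF assms(3) bdd_below_dist(1)] that by blast
qed

text \<open>The contrapositive of \<open>hausdorff_dist_less_obtain\<close>: a smaller distance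
  would give \<open>x\<close> a point of \<open>L\<close> closer than \<open>r\<close>.\<close>

lemma hausdorff_dist_geI:
  assumes "K \<noteq> {}" "L \<noteq> {}" "x \<in> K" "\<And>y. y \<in> L \<Longrightarrow> r \<le> d x y"
  shows "r \<le> hausdorff_dist d K L"
  by (meson assms hausdorff_dist_less_obtain not_le)

lemma hausdorff_dist_image_le:
  assumes "K \<noteq> {}" "L \<noteq> {}" "0 < C" "K \<subseteq> M" "L \<subseteq> M"
    and lip: "\<And>x y. x \<in> M \<Longrightarrow> y \<in> M \<Longrightarrow> d (f x) (f y) \<le> C * d x y"
  shows "hausdorff_dist d (f ` K) (f ` L) \<le> C * hausdorff_dist d K L"
proof (rule field_le_epsilon)
  fix e :: real
  assume "0 < e"
  \<comment> \<open>The slack \<open>e / C\<close> is scaled so that multiplying \<open>r\<close> by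
    \<open>C\<close> costs exactly \<open>e\<close>.\<close>
  define r where "r = hausdorff_dist d K L + e / C"
  have r: "hausdorff_dist d K L < r" "C * r = C * hausdorff_dist d K L + e"
    using \<open>0 < e\<close> \<open>0 < C\<close> by (auto simp: r_def field_simps)
  \<comment> \<open>Stated for arbitrary \<open>K'\<close> and \<open>L'\<close> because both
    directions of the Hausdorff distance use it, with the roles of \<open>K\<close> and
    \<open>L\<close> exchanged.\<close>
  have image_near: "\<exists>y\<in>f ` L'. d (f x) y \<le> C * r"
    if near: "hausdorff_dist d K' L' < r" "x \<in> K'" "L' \<noteq> {}" "K' \<subseteq> M" "L' \<subseteq> M" for K' L' x
  proof -
    obtain y where y: "y \<in> L'" "d x y < r"
      using near hausdorff_dist_less_obtain[of K' L' r x] by blast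
    have "d (f x) (f y) \<le> C * d x y"
      using lip near y by blast
    also have "\<dots> \<le> C * r"
      using y \<open>0 < C\<close> by simp
    finally show ?thesis
      using y by blast
  qed
  have "hausdorff_dist d (f ` K) (f ` L) \<le> C * r"
  proof (rule hausdorff_dist_leI)
    show "\<exists>y\<in>f ` L. d x y \<le> C * r" if "x \<in> f ` K" for x
      using image_near[of K L] that assms r by blast
    show "\<exists>x\<in>f ` K. d x y \<le> C * r" if "y \<in> f ` L" for y
      using image_near[of L K] that assms r commute hausdorff_dist_commute by (metis imageE)
  qed (use assms in auto)
  then show "hausdorff_dist d (f ` K) (f ` L) \<le> C * hausdorff_dist d K L + e"
    using r by simp
qed

lemma hausdorff_dist_triangle:
  assumes "K \<noteq> {}" "L \<noteq> {}" "N \<noteq> {}" "K \<subseteq> M" "L \<subseteq> M" "N \<subseteq> M"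
  shows "hausdorff_dist d K N \<le> hausdorff_dist d K L + hausdorff_dist d L N"
proof (rule field_le_epsilon)
  fix e :: real
  assume "0 < e"
  define r s where "r = hausdorff_dist d K L + e / 2" and "s = hausdorff_dist d L N + e / 2"
  have rs: "hausdorff_dist d K L < r" "hausdorff_dist d L N < s"
    using \<open>0 < e\<close> by (auto simp: r_def s_def)
  have "hausdorff_dist d K N \<le> r + s"
  proof (rule hausdorff_dist_leI)
    fix x assume x: "x \<in> K"
    obtain y where y: "y \<in> L" "d x y < r"
      using hausdorff_dist_less_obtain[OF rs(1)] assms x by blast
    obtain z where z: "z \<in> N" "d y z < s"
      using hausdorff_dist_less_obtain[OF rs(2)] assms y by blast
    have "d x z \<le> d x y + d y z"
      using x y z assms by (intro triangle) auto
    then show "\<exists>z\<in>N. d x z \<le> r + s"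
      using y z by (intro bexI[of _ z]) auto
  next
    fix z assume z: "z \<in> N"
    obtain y where y: "y \<in> L" "d z y < s"
      using hausdorff_dist_less_obtain[of N L s z] rs assms z hausdorff_dist_commute by metis
    obtain x where x: "x \<in> K" "d y x < r"
      using hausdorff_dist_less_obtain[of L K r y] rs assms y hausdorff_dist_commute by metis
    have "d x z \<le> d x y + d y z"
      using x y z assms by (intro triangle) auto
    then show "\<exists>x\<in>K. d x z \<le> r + s"
      using x y commute by (intro bexI[of _ x]) (auto simp: commute)
  qed (use assms in auto)
  then show "hausdorff_dist d K N \<le> hausdorff_dist d K L + hausdorff_dist d L N + e"
    by (simp add: r_def s_def)
qed

section \<open>The hyperspace as a metric space and continuity of induced maps\<close>

lemma hyperspace_iff: "K \<in> hyperspace M d \<longleftrightarrow> K \<noteq> {} \<and> compactin mtopology K"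
  by (simp add: hyperspace_def)

lemma hyperspaceD:
  assumes "K \<in> hyperspace M d"
  shows "K \<noteq> {}" "K \<subseteq> M"
  using assms compactin_subset_topspace[of mtopology K] by (auto simp: hyperspace_iff)

text \<open>Distance zero puts every point of \<open>K\<close> in the closure of \<open>L\<close>,
  and \<open>L\<close> is closed, being compact in a Hausdorff space.\<close>

lemma hausdorff_dist_zero_imp_subset:
  assumes "K \<in> hyperspace M d" "L \<in> hyperspace M d" "hausdorff_dist d K L = 0"
  shows "K \<subseteq> L"
proof
  fix x assume "x \<in> K"
  have "\<exists>y\<in>L. y \<in> mball x r" if "0 < r" for r
    using hausdorff_dist_less_obtain[of K L r x] that assms \<open>x \<in> K\<close> hyperspaceD
    by (metis in_mball subsetD)
  then have "x \<in> mtopology closure_of L"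
    using \<open>x \<in> K\<close> assms(1) hyperspaceD by (auto simp: metric_closure_of)
  moreover have "closedin mtopology L"
    using assms(2) compactin_imp_closedin[OF Hausdorff_space_mtopology]
    by (auto simp: hyperspace_iff)
  ultimately show "x \<in> L"
    by (simp add: closure_of_closedin)
qed

lemma Metric_space_hyperspace: "Metric_space (hyperspace M d) (hausdorff_dist d)"
proof
  fix K L N
  assume K: "K \<in> hyperspace M d" and L: "L \<in> hyperspace M d"
  have "hausdorff_dist d K K \<le> 0"
    using hyperspaceD[OF K] by (intro hausdorff_dist_leI bexI) auto
  then have "hausdorff_dist d K K = 0"
    using hausdorff_dist_nonneg[of K K] by simp
  then show "hausdorff_dist d K L = 0 \<longleftrightarrow> K = L"
    using hausdorff_dist_zero_imp_subset[OF K L] hausdorff_dist_zero_imp_subset[OF L K]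
    by (auto simp: hausdorff_dist_commute)
  assume N: "N \<in> hyperspace M d"
  show "hausdorff_dist d K N \<le> hausdorff_dist d K L + hausdorff_dist d L N"
    using K L N by (intro hausdorff_dist_triangle) (simp_all add: hyperspaceD)
qed (simp_all add: hausdorff_dist_nonneg hausdorff_dist_commute)

text \<open>Serves at two levels: for maps of the base space and, once the hyperspace is seen to be
  a bounded metric space, for the maps induced on it.\<close>

lemma lipschitz_imp_continuous_map:
  assumes "f ` M \<subseteq> M" "0 < C"
    and lip: "\<And>x y. x \<in> M \<Longrightarrow> y \<in> M \<Longrightarrow> d (f x) (f y) \<le> C * d x y"
  shows "continuous_map mtopology mtopology f"
proof -
  have "\<exists>\<delta>>0. \<forall>x. x \<in> M \<and> d a x < \<delta> \<longrightarrow> d (f a) (f x) < \<epsilon>"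
    if "a \<in> M" "0 < \<epsilon>" for a and \<epsilon> :: real
  proof (intro exI[of _ "\<epsilon> / C"] conjI allI impI)
    show "0 < \<epsilon> / C" using that assms by simp
    fix x assume x: "x \<in> M \<and> d a x < \<epsilon> / C"
    then have "C * d a x < \<epsilon>"
      using assms(2) by (simp add: field_simps)
    then show "d (f a) (f x) < \<epsilon>"
      using lip[of a x] x that by simp
  qed
  then show ?thesis
    using assms(1) metric_continuous_map[OF Metric_space_axioms] by blast
qed

lemma image_in_hyperspace:
  assumes "continuous_map mtopology mtopology f" "K \<in> hyperspace M d"
  shows "f ` K \<in> hyperspace M d"
  using assms by (auto simp: hyperspace_iff intro: image_compactin)

text \<open>Makes the locale applicable to its own hyperspace. The assumption
  \<open>0 \<le> B\<close> covers the value \<open>0\<close> that the distance takes when one set is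
  empty.\<close>

lemma hyperspace_bounded_metric_space:
  assumes "0 \<le> B"
  shows "bounded_metric_space (hyperspace M d) (hausdorff_dist d) B"
proof -
  have "hausdorff_dist d K L \<le> B" for K L
  proof (cases "K = {} \<or> L = {}")
    case False
    then show ?thesis
      using bounded by (intro hausdorff_dist_leI) auto
  qed (use assms in \<open>auto simp: hausdorff_dist_def\<close>)
  then show ?thesis
    using Metric_space_hyperspace
    by (simp add: bounded_metric_space_def bounded_metric_space_axioms_def)
qed

lemma continuous_map_hyperspace_image:
  assumes "f ` M \<subseteq> M" "0 < C" "0 \<le> B"
    and "\<And>x y. x \<in> M \<Longrightarrow> y \<in> M \<Longrightarrow> d (f x) (f y) \<le> C * d x y"
  shows "continuous_map (Metric_space.mtopology (hyperspace M d) (hausdorff_dist d))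
           (Metric_space.mtopology (hyperspace M d) (hausdorff_dist d)) ((`) f)"
proof -
  interpret H: bounded_metric_space "hyperspace M d" "hausdorff_dist d" B
    using assms by (intro hyperspace_bounded_metric_space)
  \<comment> \<open>Continuity on the base space keeps images of compact sets compact, so the
    induced map stays inside the hyperspace.\<close>
  have "continuous_map mtopology mtopology f"
    using assms by (intro lipschitz_imp_continuous_map)
  then show ?thesis
    using assms by (intro H.lipschitz_imp_continuous_map[of _ C] hausdorff_dist_image_le)
      (auto intro: image_in_hyperspace simp: hyperspaceD)
qed

end

section \<open>The metric on the shift space\<close>

lemma summable_shift_dist:
  "summable (\<lambda>i. discrete_metric.dd (x i) (y i) / 2 ^ i :: real)"
proof (rule summable_comparison_test')
  show "summable (\<lambda>i. (1/2) ^ i :: real)"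
    by (rule summable_geometric) simp
qed (auto simp: discrete_metric.dd_def power_one_over)

lemma shift_dist_commute: "shift_dist x y = shift_dist y x"
  by (simp add: shift_dist_def discrete_metric.dd_def eq_commute)

text \<open>Every position where \<open>u\<close> and \<open>v\<close> differ is one where
  \<open>x\<close> and \<open>y\<close> differ, so the series compare termwise. This makes the
  truncation map of the main proof 1-Lipschitz.\<close>

lemma shift_dist_mono:
  assumes "\<And>i. x i = y i \<Longrightarrow> u i = v i"
  shows "shift_dist u v \<le> shift_dist x y"
  unfolding shift_dist_def
  using assms
  by (intro suminf_le summable_shift_dist) (auto simp: discrete_metric.dd_def divide_simps)

lemma shift_dist_nonneg: "0 \<le> shift_dist x y"
  unfolding shift_dist_def
  by (intro suminf_nonneg summable_shift_dist) (simp add: discrete_metric.dd_def)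

lemma shift_dist_le_2: "shift_dist x y \<le> 2"
proof -
  have "shift_dist x y \<le> (\<Sum>i. (1/2) ^ i)"
    unfolding shift_dist_def
    by (intro suminf_le summable_shift_dist summable_geometric)
      (auto simp: discrete_metric.dd_def power_one_over)
  then show ?thesis
    by (simp add: suminf_geometric)
qed

lemma shift_dist_eq_0_iff: "shift_dist x y = 0 \<longleftrightarrow> x = y"
proof -
  have "shift_dist x y = 0 \<longleftrightarrow> (\<forall>i. discrete_metric.dd (x i) (y i) / 2 ^ i = (0::real))"
    unfolding shift_dist_def
    by (intro suminf_eq_zero_iff summable_shift_dist) (simp add: discrete_metric.dd_def)
  then show ?thesis
    by (auto simp: discrete_metric.dd_def fun_eq_iff)
qed

lemma shift_dist_triangle: "shift_dist x z \<le> shift_dist x y + shift_dist y z"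
  unfolding shift_dist_def suminf_add[OF summable_shift_dist summable_shift_dist]
  by (intro suminf_le summable_add summable_shift_dist)
    (auto simp: discrete_metric.dd_def divide_simps)

text \<open>Splitting off the term at position 0 leaves a series whose weights are halved. The
  Lipschitz constant 2 of \<open>shift\<close>, the lower bound 1 and the prefix estimate all come
  from this recursion.\<close>

lemma shift_dist_unfold:
  "shift_dist x y = discrete_metric.dd (x 0) (y 0) + shift_dist (shift x) (shift y) / 2"
proof -
  have "shift_dist (shift x) (shift y) / 2
      = (\<Sum>i. discrete_metric.dd (x (Suc i)) (y (Suc i)) / 2 ^ Suc i)"
    unfolding shift_dist_def shift_def suminf_divide[OF summable_shift_dist, symmetric]
    by (simp add: mult.commute)
  also have "\<dots> = shift_dist x y - discrete_metric.dd (x 0) (y 0)"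
    using suminf_split_head[OF summable_shift_dist[of x y]] by (simp add: shift_dist_def)
  finally show ?thesis
    by linarith
qed

lemma shift_dist_shift_le: "shift_dist (shift x) (shift y) \<le> 2 * shift_dist x y"
  using shift_dist_unfold[of x y] by (simp add: discrete_metric.dd_def split: if_splits)

lemma shift_dist_ge_1: "x 0 \<noteq> y 0 \<Longrightarrow> 1 \<le> shift_dist x y"
  using shift_dist_unfold[of x y] shift_dist_nonneg[of "shift x" "shift y"]
  by (simp add: discrete_metric.dd_def)

text \<open>Each common first letter halves the bound, starting from the global bound 2.\<close>

lemma shift_dist_eq_prefix_le:
  "(\<And>i. i < n \<Longrightarrow> x i = y i) \<Longrightarrow> shift_dist x y \<le> 2 / 2 ^ n"
proof (induction n arbitrary: x y)
  case 0
  then show ?case by (simp add: shift_dist_le_2)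
next
  case (Suc n)
  have "shift_dist (shift x) (shift y) \<le> 2 / 2 ^ n"
    using Suc.prems by (intro Suc.IH) (simp add: shift_def)
  then show ?case
    using shift_dist_unfold[of x y] Suc.prems[of 0] by (simp add: discrete_metric.dd_def)
qed

lemma bounded_metric_space_full_shift: "bounded_metric_space (full_shift A) shift_dist 2"
  by unfold_locales
    (simp_all add: shift_dist_nonneg shift_dist_commute shift_dist_eq_0_iff shift_dist_triangle
      shift_dist_le_2)

section \<open>Iterates of the shift and sensitivity\<close>

lemma funpow_image:
  fixes f :: "'a \<Rightarrow> 'a"
  shows "((`) f ^^ n) K = (f ^^ n) ` K"
  by (induction n) (simp_all add: image_comp)

lemma funpow_shift: "(shift ^^ n) x = (\<lambda>i. x (i + n))"
  by (induction n) (simp_all add: shift_def)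

theorem proposition3p3:
  fixes A :: "'a set"
  assumes "\<exists>a\<in>A. \<exists>b\<in>A. a \<noteq> b"
  shows "sensitive_with_constant (hyperspace (full_shift A) shift_dist)
           (hausdorff_dist shift_dist) ((`) shift) (1/2)"
proof -
  interpret bounded_metric_space "full_shift A" shift_dist 2
    by (rule bounded_metric_space_full_shift)
  let ?H = "hyperspace (full_shift A) shift_dist" and ?h = "hausdorff_dist shift_dist"
  have "\<exists>L\<in>?H. \<exists>n>0. ?h K L < \<epsilon> \<and> 1/2 < ?h (((`) shift ^^ n) K) (((`) shift ^^ n) L)"
    if K: "K \<in> ?H" and "0 < \<epsilon>" for K and \<epsilon> :: real
  proof -
    obtain m where m: "(1/2) ^ m < \<epsilon>"
      using real_arch_pow_inv[of \<epsilon> "1/2"] \<open>0 < \<epsilon>\<close> by auto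
    \<comment> \<open>The extra step turns the prefix bound \<open>2 / 2 ^ n\<close> into
      \<open>(1/2) ^ m\<close> and ensures that \<open>n\<close> is positive.\<close>
    define n where "n = Suc m"
    obtain z where z: "z \<in> K"
      using hyperspaceD[OF K] by blast
    \<comment> \<open>Two distinct letters exist, so one of them differs from \<open>z n\<close>,
      the letter that \<open>n\<close> shifts bring to position 0.\<close>
    obtain c where c: "c \<in> A" "c \<noteq> z n"
      using assms by metis
    define f where "f x = (\<lambda>i. if i < n then x i else c)" for x
    define L where "L = f ` K"
    \<comment> \<open>Where two sequences agree, their truncations agree as well, so
      \<open>f\<close> is 1-Lipschitz; hence \<open>L\<close> is compact as a continuous image of
      \<open>K\<close>.\<close>
    have "continuous_map mtopology mtopology f"
    proof (rule lipschitz_imp_continuous_map)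
      show "f ` full_shift A \<subseteq> full_shift A"
        using c by (auto simp: f_def full_shift_def)
      show "shift_dist (f x) (f y) \<le> 1 * shift_dist x y" for x y
        by (simp add: f_def shift_dist_mono)
    qed simp
    then have L: "L \<in> ?H"
      unfolding L_def using K by (rule image_in_hyperspace)
    have "shift_dist x (f x) \<le> 2 / 2 ^ n" for x
      by (rule shift_dist_eq_prefix_le) (simp add: f_def)
    then have "?h K L \<le> 2 / 2 ^ n"
      using hyperspaceD[OF K] by (intro hausdorff_dist_leI) (auto simp: L_def)
    also have "\<dots> < \<epsilon>"
      using m by (simp add: n_def power_one_over)
    finally have "?h K L < \<epsilon>" .
    moreover have "1 \<le> ?h ((shift ^^ n) ` K) ((shift ^^ n) ` L)"
    proof (rule hausdorff_dist_geI)
      show "(shift ^^ n) z \<in> (shift ^^ n) ` K"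
        using z by simp
      \<comment> \<open>After \<open>n\<close> shifts every point of \<open>L\<close> begins with
        \<open>c\<close>, whereas the shifted \<open>z\<close> begins with \<open>z n\<close>; the
        first term of the series alone contributes 1.\<close>
      show "1 \<le> shift_dist ((shift ^^ n) z) y" if "y \<in> (shift ^^ n) ` L" for y
        using that c by (intro shift_dist_ge_1) (auto simp: L_def f_def funpow_shift)
    qed (use hyperspaceD[OF K] hyperspaceD[OF L] in auto)
    ultimately show ?thesis
      using L by (intro bexI[of _ L] exI[of _ n]) (auto simp: funpow_image n_def simp del: funpow.simps)
  qed
  moreover have "continuous_map (Metric_space.mtopology ?H ?h) (Metric_space.mtopology ?H ?h) ((`) shift)"
    using shift_dist_shift_le
    by (intro continuous_map_hyperspace_image[of _ 2]) (auto simp: full_shift_def shift_def)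
  ultimately show ?thesis
    unfolding sensitive_with_constant_def using Metric_space_hyperspace by auto
qed

end
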